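(* Let \[ M_1=\begin{pmatrix} -1 & 2 & 2 \\ -2 & 1 & 2 \\ -2 & 2 & 3 \end{pmatrix},\quad M_2=\begin{pmatrix} 1 & 2 & 2 \\ 2 & 1 & 2 \\ 2 & 2 & 3 \end{pmatrix},\quad M_3=\begin{pmatrix} 1 & -2 & 2 \\ 2 & -1 & 2 \\ 2 & -2 & 3 \end{pmatrix}. \] Consider the directed graph whose vertices are all primitive Pythagorean triples $(a,b,c)$ (positive integers with $\gcd(a,b,c)=1$ and $a^2+b^2=c^2$, viewed as column vectors), with an edge from $\mathbf{v}$ to $\mathbf{v}'$ whenever $\mathbf{v}'=M_j\mathbf{v}$ for some $j\in\{1,2,3\}$. Call a vertex $(a,b,c)$ a funnel vertex if (i) it has outdegree $3$, (ii) it has indegree $1$, and (iii) every vertex at the head of an edge coming out of $(a,b,c)$ has third coordinate greater than $c$, while the vertex at the tail of the edge going into $(a,b,c)$ has third coordinate smaller than $c$. Then every primitive Pythagorean triple other than $(3,4,5)$ and $(4,3,5)$ is a funnel vertex. *)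

theory Defs
  imports "HOL-Analysis.Cartesian_Space" "Graph_Theory.Digraph"
begin

definition M1 :: "int ^ 3 ^ 3" where
  "M1 = vector [vector [-1, 2, 2], vector [-2, 1, 2], vector [-2, 2, 3]]"

definition M2 :: "int ^ 3 ^ 3" where
  "M2 = vector [vector [1, 2, 2], vector [2, 1, 2], vector [2, 2, 3]]"

definition M3 :: "int ^ 3 ^ 3" where
  "M3 = vector [vector [1, -2, 2], vector [2, -1, 2], vector [2, -2, 3]]"

definition primitive_pythagorean_triple :: "int ^ 3 \<Rightarrow> bool" where
  "primitive_pythagorean_triple v \<longleftrightarrow>
     0 < v $ 1 \<and> 0 < v $ 2 \<and> 0 < v $ 3 \<and>
     gcd (v $ 1) (gcd (v $ 2) (v $ 3)) = 1 \<and>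
     (v $ 1)\<^sup>2 + (v $ 2)\<^sup>2 = (v $ 3)\<^sup>2"

text \<open>
  Arcs are ordered pairs of vertices, so two different matrices sending \<open>v\<close> to the same
  vertex would give only one arc.
\<close>

definition ppt_graph :: "(int ^ 3, (int ^ 3) \<times> (int ^ 3)) pre_digraph" where
  "ppt_graph =
     \<lparr> verts = {v. primitive_pythagorean_triple v},
       arcs = {(v, v'). primitive_pythagorean_triple v \<and> primitive_pythagorean_triple v' \<and>
                        (\<exists>M \<in> {M1, M2, M3}. v' = M *v v)},
       tail = fst,
       head = snd \<rparr>"

definition funnel_vertex :: "int ^ 3 \<Rightarrow> bool" where
  "funnel_vertex v \<longleftrightarrow>
     v \<in> verts ppt_graph \<and>
     out_degree ppt_graph v = 3 \<and>
     in_degree ppt_graph v = 1 \<and>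
     (\<forall>e \<in> out_arcs ppt_graph v. head ppt_graph e $ 3 > v $ 3) \<and>
     (\<forall>e \<in> in_arcs ppt_graph v. tail ppt_graph e $ 3 < v $ 3)"

end

theory Submission
  imports Defs
begin

text \<open>
  The matrices preserve the form \<open>x\<^sup>2 + y\<^sup>2 - z\<^sup>2\<close> and are invertible over the integers, so a
  preimage of a primitive triple \<open>(a, b, c)\<close> is a primitive triple as soon as it is positive.
  With \<open>p = a + 2b - 2c\<close>, \<open>q = 2a + b - 2c\<close> and \<open>r = 3c - 2a - 2b\<close>, the preimages under
  \<open>M\<^sub>1\<close>, \<open>M\<^sub>2\<close>, \<open>M\<^sub>3\<close> are \<open>(-p, q, r)\<close>, \<open>(p, q, r)\<close>, \<open>(p, -q, r)\<close>. Here \<open>0 < r < c\<close>, while \<open>p\<close> has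
  the sign of \<open>4b - 3a\<close> and \<open>q\<close> that of \<open>4a - 3b\<close>. They are never both negative and
  vanish only for \<open>(4, 3, 5)\<close> and \<open>(3, 4, 5)\<close>, so otherwise exactly one preimage is positive.
\<close>

text \<open>\<open>N1\<close>, \<open>N2\<close>, \<open>N3\<close> are the inverses of
  \<open>M1\<close>, \<open>M2\<close>, \<open>M3\<close>; that they are integral lets primitivity
  pass in both directions along an edge.\<close>

definition N1 :: "int ^ 3 ^ 3" where
  "N1 = vector [vector [-1, -2, 2], vector [2, 1, -2], vector [-2, -2, 3]]"

definition N2 :: "int ^ 3 ^ 3" where
  "N2 = vector [vector [1, 2, -2], vector [2, 1, -2], vector [-2, -2, 3]]"

definition N3 :: "int ^ 3 ^ 3" where
  "N3 = vector [vector [1, 2, -2], vector [-2, -1, 2], vector [-2, -2, 3]]"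

lemmas matrix_mult_nth =
  M1_def M2_def M3_def matrix_vector_mult_def sum_3

lemma matrix_vector_mult_eq_iff:
  fixes A B :: "'a::comm_semiring_1 ^ 'n ^ 'n"
  assumes "A ** B = mat 1" and "B ** A = mat 1"
  shows "v = A *v u \<longleftrightarrow> u = B *v v"
  using assms by (metis matrix_vector_mul_assoc matrix_vector_mul_lid)

lemma M_mult_eq_iff:
  shows "v = M1 *v u \<longleftrightarrow> u = N1 *v v"
    and "v = M2 *v u \<longleftrightarrow> u = N2 *v v"
    and "v = M3 *v u \<longleftrightarrow> u = N3 *v v"
  by (rule matrix_vector_mult_eq_iff;
      simp add: M1_def M2_def M3_def N1_def N2_def N3_def matrix_matrix_mult_def mat_def
        vec_eq_iff forall_3 sum_3)+

text \<open>The entries of \<open>x\<close> are integer combinations of those of \<open>y\<close>,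
  so a common divisor of the latter divides the former.\<close>

lemma gcd3_eq_1_if_matrix_mult:
  fixes x y :: "int ^ 3"
  assumes "x = A *v y" and x: "gcd (x $ 1) (gcd (x $ 2) (x $ 3)) = 1"
  shows "gcd (y $ 1) (gcd (y $ 2) (y $ 3)) = 1" (is "?d = 1")
proof -
  have "?d dvd y $ j" for j
    using exhaust_3[of j] by (auto intro: dvd_trans[OF gcd_dvd2])
  then have "?d dvd x $ i" for i
    by (auto simp: assms(1) matrix_vector_mult_def intro: dvd_sum)
  then have "?d dvd gcd (x $ 1) (gcd (x $ 2) (x $ 3))"
    by (intro gcd_greatest)
  then show ?thesis
    by (simp add: x)
qed

text \<open>Serves both directions, for children and for the parent. Positivity is assumed on both
  sides because the matrices transfer only the gcd condition and the quadratic form.\<close>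

lemma primitive_pythagorean_triple_M_mult_iff:
  assumes "v = M *v u" and "M \<in> {M1, M2, M3}"
    and "0 < v $ 1" "0 < v $ 2" "0 < v $ 3" and "0 < u $ 1" "0 < u $ 2" "0 < u $ 3"
  shows "primitive_pythagorean_triple v \<longleftrightarrow> primitive_pythagorean_triple u"
proof -
  obtain N where "u = N *v v"
    using assms(1,2) M_mult_eq_iff by blast
  then have "gcd (v $ 1) (gcd (v $ 2) (v $ 3)) = 1 \<longleftrightarrow> gcd (u $ 1) (gcd (u $ 2) (u $ 3)) = 1"
    using gcd3_eq_1_if_matrix_mult[OF assms(1)] gcd3_eq_1_if_matrix_mult[of u N v] by argo
  moreover have "(v $ 1)\<^sup>2 + (v $ 2)\<^sup>2 - (v $ 3)\<^sup>2 = (u $ 1)\<^sup>2 + (u $ 2)\<^sup>2 - (u $ 3)\<^sup>2"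
    using assms(1,2) by (auto simp: matrix_mult_nth power2_eq_square algebra_simps)
  then have "(v $ 1)\<^sup>2 + (v $ 2)\<^sup>2 = (v $ 3)\<^sup>2 \<longleftrightarrow> (u $ 1)\<^sup>2 + (u $ 2)\<^sup>2 = (u $ 3)\<^sup>2"
    by linarith
  ultimately show ?thesis
    using assms(3-) by (simp only: primitive_pythagorean_triple_def)
qed

context
  fixes v :: "int ^ 3"
  assumes v: "primitive_pythagorean_triple v"
begin

lemma legs_pos: "0 < v $ 1" "0 < v $ 2" "0 < v $ 3"
  and pythagoras: "(v $ 1)\<^sup>2 + (v $ 2)\<^sup>2 = (v $ 3)\<^sup>2"
  using v by (auto simp: primitive_pythagorean_triple_def)

lemma legs_less: "v $ 1 < v $ 3" "v $ 2 < v $ 3"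
  by (rule power2_less_imp_less; use legs_pos in \<open>simp flip: pythagoras\<close>)+

lemma hypotenuse_less: "v $ 3 < v $ 1 + v $ 2"
  by (rule power2_less_imp_less) (use legs_pos in \<open>simp_all flip: pythagoras add: power2_sum\<close>)

lemma child:
  assumes "M \<in> {M1, M2, M3}"
  shows "primitive_pythagorean_triple (M *v v)" and "v $ 3 < (M *v v) $ 3"
proof -
  \<comment> \<open>Only \<open>M1\<close> and \<open>M3\<close> have negative entries; there each
    subtracted leg is outweighed by the hypotenuse term, by \<open>legs_less\<close>.\<close>
  have "0 < (M *v v) $ 1" "0 < (M *v v) $ 2" and less: "v $ 3 < (M *v v) $ 3"
    using assms legs_pos legs_less by (auto simp: matrix_mult_nth)
  then show "primitive_pythagorean_triple (M *v v)"
    using v legs_pos by (simp add: primitive_pythagorean_triple_M_mult_iff[OF refl assms])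
  show "v $ 3 < (M *v v) $ 3"
    by (fact less)
qed

lemma children_distinct: "M1 *v v \<noteq> M2 *v v" "M1 *v v \<noteq> M3 *v v" "M2 *v v \<noteq> M3 *v v"
proof -
  have "(M1 *v v) $ 1 \<noteq> (M2 *v v) $ 1" "(M2 *v v) $ 1 \<noteq> (M3 *v v) $ 1"
    \<comment> \<open>With legs \<open>a\<close> and \<open>b\<close>, equal first entries would
      mean \<open>a = 2 * b\<close>, and equal third entries \<open>a = b\<close>; together these
      give \<open>b = 0\<close>.\<close>
    "(M1 *v v) $ 1 \<noteq> (M3 *v v) $ 1 \<or> (M1 *v v) $ 3 \<noteq> (M3 *v v) $ 3"
    using legs_pos by (auto simp: matrix_mult_nth)
  then show "M1 *v v \<noteq> M2 *v v" "M1 *v v \<noteq> M3 *v v" "M2 *v v \<noteq> M3 *v v"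
    by metis+
qed

lemma out_arcs_ppt_graph:
  "out_arcs ppt_graph v = {(v, M1 *v v), (v, M2 *v v), (v, M3 *v v)}"
proof -
  have "primitive_pythagorean_triple (M1 *v v)" "primitive_pythagorean_triple (M2 *v v)"
    "primitive_pythagorean_triple (M3 *v v)"
    by (simp_all add: child(1))
  with v show ?thesis
    by (auto simp: ppt_graph_def out_arcs_def)
qed

lemma out_degree_ppt_graph: "out_degree ppt_graph v = 3"
  by (simp add: out_degree_def out_arcs_ppt_graph children_distinct)

lemma parent_hypotenuse:
  shows "0 < 3 * v $ 3 - 2 * v $ 1 - 2 * v $ 2"
    and "3 * v $ 3 - 2 * v $ 1 - 2 * v $ 2 < v $ 3"
proof -
  \<comment> \<open>The parallelogram law: the squares of the sum and the difference of the legs add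
    up to twice the square of the hypotenuse.\<close>
  have "(2 * v $ 1 + 2 * v $ 2)\<^sup>2 + 4 * (v $ 1 - v $ 2)\<^sup>2 + (v $ 3)\<^sup>2 = (3 * v $ 3)\<^sup>2"
    using pythagoras by (simp add: power2_eq_square algebra_simps)
  moreover have "0 < (v $ 3)\<^sup>2" "0 \<le> (v $ 1 - v $ 2)\<^sup>2"
    using legs_pos by auto
  ultimately have "(2 * v $ 1 + 2 * v $ 2)\<^sup>2 < (3 * v $ 3)\<^sup>2"
    by linarith
  then have "2 * v $ 1 + 2 * v $ 2 < 3 * v $ 3"
    by (rule power2_less_imp_less) (use legs_pos in simp)
  then show "0 < 3 * v $ 3 - 2 * v $ 1 - 2 * v $ 2"
    by simp
  show "3 * v $ 3 - 2 * v $ 1 - 2 * v $ 2 < v $ 3"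
    using hypotenuse_less by simp
qed

lemma sgn_parent_legs:
  shows "sgn (v $ 1 + 2 * v $ 2 - 2 * v $ 3) = sgn (4 * v $ 2 - 3 * v $ 1)" (is "sgn ?p = _")
    and "sgn (2 * v $ 1 + v $ 2 - 2 * v $ 3) = sgn (4 * v $ 1 - 3 * v $ 2)" (is "sgn ?q = _")
proof -
  \<comment> \<open>Multiplying by the positive conjugate gives a difference of squares, and
    substituting for the squared hypotenuse leaves a leg as a factor.\<close>
  have "?p * (v $ 1 + 2 * v $ 2 + 2 * v $ 3) = v $ 1 * (4 * v $ 2 - 3 * v $ 1)"
    "?q * (2 * v $ 1 + v $ 2 + 2 * v $ 3) = v $ 2 * (4 * v $ 1 - 3 * v $ 2)"
    using pythagoras by (simp_all add: power2_eq_square algebra_simps)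
  from this[THEN arg_cong[where f = sgn]]
  show "sgn ?p = sgn (4 * v $ 2 - 3 * v $ 1)" "sgn ?q = sgn (4 * v $ 1 - 3 * v $ 2)"
    using legs_pos by (simp_all add: sgn_mult)
qed

text \<open>The hypotenuse must be \<open>5 * k\<close>, so \<open>k\<close> divides all three
  entries and primitivity forces \<open>k = 1\<close>.\<close>

lemma eq_345_triple:
  assumes "v $ 1 = 4 * k \<and> v $ 2 = 3 * k \<or> v $ 1 = 3 * k \<and> v $ 2 = 4 * k"
  shows "v = vector [4, 3, 5] \<or> v = vector [3, 4, 5]"
proof -
  have k: "0 < k"
    using assms legs_pos by auto
  have "(v $ 3)\<^sup>2 = (5 * k)\<^sup>2"
    using assms by (auto simp: power_mult_distrib simp flip: pythagoras)
  then have c: "v $ 3 = 5 * k"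
    by (rule power2_eq_imp_eq) (use legs_pos k in simp_all)
  have "k dvd gcd (v $ 1) (gcd (v $ 2) (v $ 3))"
    using assms c by (intro gcd_greatest) auto
  moreover have "gcd (v $ 1) (gcd (v $ 2) (v $ 3)) = 1"
    using v by (simp only: primitive_pythagorean_triple_def)
  ultimately have "k = 1"
    using k by simp
  with assms c have "v $ 1 = 4 \<and> v $ 2 = 3 \<and> v $ 3 = 5 \<or> v $ 1 = 3 \<and> v $ 2 = 4 \<and> v $ 3 = 5"
    by simp
  then show ?thesis
    by (simp add: vec_eq_iff forall_3)
qed

lemma parent_legs_nonzero:
  assumes "v \<noteq> vector [3, 4, 5]" and "v \<noteq> vector [4, 3, 5]"
  shows "v $ 1 + 2 * v $ 2 - 2 * v $ 3 \<noteq> 0" and "2 * v $ 1 + v $ 2 - 2 * v $ 3 \<noteq> 0"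
proof -
  have "4 * v $ 2 \<noteq> 3 * v $ 1"
  proof
    assume "4 * v $ 2 = 3 * v $ 1"
    \<comment> \<open>Legs \<open>4 * k\<close> and \<open>3 * k\<close> differ by \<open>k\<close>,
      so their difference is the witness.\<close>
    then have "v $ 1 = 4 * (v $ 1 - v $ 2) \<and> v $ 2 = 3 * (v $ 1 - v $ 2)"
      by auto
    then show False
      using eq_345_triple assms by blast
  qed
  moreover have "4 * v $ 1 \<noteq> 3 * v $ 2"
  proof
    assume "4 * v $ 1 = 3 * v $ 2"
    then have "v $ 1 = 3 * (v $ 2 - v $ 1) \<and> v $ 2 = 4 * (v $ 2 - v $ 1)"
      by auto
    then show False
      using eq_345_triple assms by blast
  qed
  ultimately show "v $ 1 + 2 * v $ 2 - 2 * v $ 3 \<noteq> 0" "2 * v $ 1 + v $ 2 - 2 * v $ 3 \<noteq> 0"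
    using sgn_parent_legs by (auto simp: sgn_if split: if_splits)
qed

lemma in_arcs_ppt_graph:
  assumes "v \<noteq> vector [3, 4, 5]" and "v \<noteq> vector [4, 3, 5]"
  obtains u where "in_arcs ppt_graph v = {(u, v)}" and "u $ 3 < v $ 3"
proof -
  define p q r where
    "p = v $ 1 + 2 * v $ 2 - 2 * v $ 3" and
    "q = 2 * v $ 1 + v $ 2 - 2 * v $ 3" and
    "r = 3 * v $ 3 - 2 * v $ 1 - 2 * v $ 2"
  have N1: "(N1 *v v) $ 1 = - p" "(N1 *v v) $ 2 = q" "(N1 *v v) $ 3 = r"
    and N2: "(N2 *v v) $ 1 = p" "(N2 *v v) $ 2 = q" "(N2 *v v) $ 3 = r"
    and N3: "(N3 *v v) $ 1 = p" "(N3 *v v) $ 2 = - q" "(N3 *v v) $ 3 = r"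
    by (simp_all add: p_def q_def r_def N1_def N2_def N3_def matrix_vector_mult_def sum_3)
  have r: "0 < r" "r < v $ 3"
    using parent_hypotenuse by (simp_all add: r_def)
  have nz: "p \<noteq> 0" "q \<noteq> 0"
    using parent_legs_nonzero assms by (simp_all add: p_def q_def)
  have "0 < p \<or> 0 < q"
  proof (rule ccontr)
    assume "\<not> (0 < p \<or> 0 < q)"
    \<comment> \<open>Adding the two inequalities gives four times the sum of the legs below three
      times that sum.\<close>
    then have "4 * v $ 2 < 3 * v $ 1" "4 * v $ 1 < 3 * v $ 2"
      using nz sgn_parent_legs by (auto simp: p_def q_def sgn_if split: if_splits)
    then show False
      using legs_pos by linarith
  qed
  then consider "p < 0" "0 < q" | "0 < p" "0 < q" | "0 < p" "q < 0"
    using nz by linarith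
  \<comment> \<open>The candidates have legs \<open>(-p, q)\<close>, \<open>(p, q)\<close> and
    \<open>(p, -q)\<close>. In each sign case one has both legs positive and the other two each have
    a negative leg, which gives existence and uniqueness together.\<close>
  then obtain u where u: "0 < u $ 1" "0 < u $ 2" "u $ 3 = r" "\<exists>M \<in> {M1, M2, M3}. v = M *v u"
    and unique: "\<And>w. \<exists>M \<in> {M1, M2, M3}. v = M *v w \<Longrightarrow> 0 < w $ 1 \<Longrightarrow> 0 < w $ 2 \<Longrightarrow> w = u"
  proof cases
    case 1
    then show ?thesis
      by (intro that[of "N1 *v v"]) (auto simp: M_mult_eq_iff N1 N2 N3)
  next
    case 2
    then show ?thesis
      by (intro that[of "N2 *v v"]) (auto simp: M_mult_eq_iff N1 N2 N3)
  next
    case 3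
    then show ?thesis
      by (intro that[of "N3 *v v"]) (auto simp: M_mult_eq_iff N1 N2 N3)
  qed
  have "primitive_pythagorean_triple u"
    using primitive_pythagorean_triple_M_mult_iff u r v legs_pos by metis
  moreover have "w = u" if "primitive_pythagorean_triple w" "\<exists>M \<in> {M1, M2, M3}. v = M *v w" for w
    using unique that by (simp only: primitive_pythagorean_triple_def)
  moreover have "in_arcs ppt_graph v =
      {(w, v) | w. primitive_pythagorean_triple w \<and> (\<exists>M \<in> {M1, M2, M3}. v = M *v w)}"
    using v by (force simp: in_arcs_def ppt_graph_def)
  ultimately have "in_arcs ppt_graph v = {(u, v)}"
    using u(4) by blast
  then show ?thesis
    using that u r by simp
qed

end

theorem theorem2p2:
  fixes v :: "int ^ 3"
  assumes "primitive_pythagorean_triple v"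
    and "v \<noteq> vector [3, 4, 5]"
    and "v \<noteq> vector [4, 3, 5]"
  shows "funnel_vertex v"
proof -
  obtain u where u: "in_arcs ppt_graph v = {(u, v)}" "u $ 3 < v $ 3"
    using in_arcs_ppt_graph assms by blast
  then have "in_degree ppt_graph v = 1"
    by (simp add: in_degree_def)
  then show ?thesis
    using assms u child(2)[OF assms(1)]
    by (auto simp: funnel_vertex_def out_degree_ppt_graph out_arcs_ppt_graph)
      (auto simp: ppt_graph_def)
qed

end
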